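(* Let $\mathbb{F}=\mathbb{R}$ or $\mathbb{C}$, let $n \geq 1$ and let $R \subset \mathbb{F}^n \times \mathbb{F}^n$ be a linorder. Then the minimum size of a decomposition of $\mathbb{F}^n$ into bi-chains for $R$ equals the maximum dimension of an antichain for $R$.
   Context: Orthogonality $\perp$ is with respect to the standard inner product on $\mathbb{F}^n$; for a subspace $C$, $v\perp C$ means $v$ is orthogonal to every element of $C$. A linorder is a relation $R \subset \mathbb{F}^n \times \mathbb{F}^n$ such that (1) if $(v,w)$ and $(\tilde v,\tilde w)$ both belong to $R$ and $w \not\perp \tilde v$, then $(v,\tilde w) \in R$; (2) $(v,w) \in R$ implies $v \perp w$. A bi-chain for $R$ is a sequence $(w_1, v_1, \ldots, w_r, v_r)$ of vectors in $\mathbb{F}^n$ ($r\ge 1$) such that $w_i \not\perp v_i$ for $1 \leq i \leq r$ and $(v_i, w_{i+1}) \in R$ for $1 \leq i < r$. A decomposition of $\mathbb{F}^n$ into bi-chains is a family of bi-chains whose $v$'s, taken together over all bi-chains in the family (as an indexed family), form a basis of $\mathbb{F}^n$ and whose $w$'s, taken together likewise, form a basis of $\mathbb{F}^n$. Its size is the number of bi-chains in the family. An antichain for $R$ is a linear subspace $C$ of $\mathbb{F}^n$ such that every $(v,w) \in R$ satisfies $v \perp C$ or $w \perp C$ (or both). *)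

theory Defs
  imports "HOL-Analysis.Analysis"
begin

text \<open>
  Everything is parametrised by the orthogonality relation \<open>perp\<close>. It is meant to be
  instantiated by the library relation \<open>orthogonal\<close> on \<open>real ^ 'n\<close> and by
  \<open>cperp\<close> below on \<open>complex ^ 'n\<close>. The library's \<open>inner\<close> on \<open>complex ^ 'n\<close> is only
  the real part of the Hermitian product, so \<open>orthogonal\<close> would be wrong there.
  Linear notions prefixed \<open>vec\<close> are over the coordinate field.
\<close>

definition cperp :: "complex ^ 'n \<Rightarrow> complex ^ 'n \<Rightarrow> bool" where
  "cperp v w \<longleftrightarrow> (\<Sum>i\<in>UNIV. v $ i * cnj (w $ i)) = 0"

definition linorder_rel ::
  "('v \<Rightarrow> 'v \<Rightarrow> bool) \<Rightarrow> ('v \<times> 'v) set \<Rightarrow> bool" where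
  "linorder_rel perp R \<longleftrightarrow>
     (\<forall>v w v' w'. (v, w) \<in> R \<and> (v', w') \<in> R \<and> \<not> perp w v' \<longrightarrow> (v, w') \<in> R) \<and>
     (\<forall>v w. (v, w) \<in> R \<longrightarrow> perp v w)"

text \<open>The sequence \<open>(w\<^sub>1, v\<^sub>1, \<dots>, w\<^sub>r, v\<^sub>r)\<close> is encoded as the list of pairs \<open>(w\<^sub>i, v\<^sub>i)\<close>.\<close>

definition bichain ::
  "('v \<Rightarrow> 'v \<Rightarrow> bool) \<Rightarrow> ('v \<times> 'v) set \<Rightarrow> ('v \<times> 'v) list \<Rightarrow> bool" where
  "bichain perp R c \<longleftrightarrow>
     c \<noteq> [] \<and>
     (\<forall>(w, v)\<in>set c. \<not> perp w v) \<and>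
     (\<forall>i. Suc i < length c \<longrightarrow> (snd (c ! i), fst (c ! Suc i)) \<in> R)"

text \<open>\<open>distinct\<close> is needed because a basis is understood as an indexed family.\<close>

definition basis_list :: "('a::field ^ 'n) list \<Rightarrow> bool" where
  "basis_list vs \<longleftrightarrow> distinct vs \<and> vec.independent (set vs) \<and> vec.span (set vs) = UNIV"

text \<open>
  Families are lists of bi-chains, and the size is the length. Only finite families can occur,
  since each bi-chain contributes at least one vector to a basis.
\<close>

definition bichain_decomposition ::
  "('a::field ^ 'n \<Rightarrow> 'a ^ 'n \<Rightarrow> bool) \<Rightarrow> (('a ^ 'n) \<times> ('a ^ 'n)) set \<Rightarrow>
   (('a ^ 'n) \<times> ('a ^ 'n)) list list \<Rightarrow> bool" where
  "bichain_decomposition perp R D \<longleftrightarrow>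
     (\<forall>c\<in>set D. bichain perp R c) \<and>
     basis_list (map snd (concat D)) \<and>
     basis_list (map fst (concat D))"

definition antichain_subspace ::
  "('a::field ^ 'n \<Rightarrow> 'a ^ 'n \<Rightarrow> bool) \<Rightarrow> (('a ^ 'n) \<times> ('a ^ 'n)) set \<Rightarrow>
   ('a ^ 'n) set \<Rightarrow> bool" where
  "antichain_subspace perp R C \<longleftrightarrow>
     vec.subspace C \<and>
     (\<forall>(v, w)\<in>R. (\<forall>c\<in>C. perp v c) \<or> (\<forall>c\<in>C. perp w c))"

end

theory Submission
  imports Defs
begin

text \<open>
  The matroid intersection theorem, applied to the first and to the second components of the pairs
  in \<open>R\<close>, gives a set \<open>I \<subseteq> R\<close> of some size \<open>m\<close> with independent first and independent second
  components, together with subspaces \<open>U\<close>, \<open>W\<close> with \<open>dim U + dim W = m\<close> such that every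
  \<open>(v, w) \<in> R\<close> has \<open>v \<in> U\<close> or \<open>w \<in> W\<close>. The orthogonal complement of \<open>U + W\<close> is an antichain of
  dimension at least \<open>n - m\<close>. Extending both component sets of \<open>I\<close> to bases and pairing these along
  nonorthogonal vectors, the elements of \<open>I\<close> link the \<open>n\<close> pairs; transitivity of \<open>R\<close> excludes cycles,
  so the links arrange the pairs into \<open>n - m\<close> bi-chains.

  Conversely let \<open>C\<close> be an antichain, let \<open>U\<close> be the span of those \<open>v\<close> for which some \<open>(v, w) \<in> R\<close>
  has \<open>w\<close> not orthogonal to \<open>C\<close>, and let \<open>W\<close> be the complement of \<open>U + C\<close>. Then \<open>U\<close>, \<open>W\<close> again cover
  \<open>R\<close>, and \<open>dim U + dim W \<le> n - dim C\<close>. A bi-chain of length \<open>r\<close> has \<open>r - 1\<close> links, each of which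
  uses up a basis vector in \<open>U\<close> or in \<open>W\<close>, so there are at least \<open>dim C\<close> bi-chains.
\<close>

section \<open>Matroid intersection\<close>

text \<open>The axioms range over all subsets of the type, without a ground set, so that a
  contraction is again a rank function on the same type.\<close>

definition matroid_rank :: "('e set \<Rightarrow> nat) \<Rightarrow> bool" where
  "matroid_rank r \<longleftrightarrow>
     r {} = 0 \<and> (\<forall>x A. r (insert x A) \<le> Suc (r A)) \<and> (\<forall>A B. A \<subseteq> B \<longrightarrow> r A \<le> r B) \<and>
     (\<forall>A B. r (A \<union> B) + r (A \<inter> B) \<le> r A + r B)"

lemma matroid_rank_empty: "matroid_rank r \<Longrightarrow> r {} = 0"
  and matroid_rank_insert_le: "matroid_rank r \<Longrightarrow> r (insert x A) \<le> Suc (r A)"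
  and matroid_rank_mono: "matroid_rank r \<Longrightarrow> A \<subseteq> B \<Longrightarrow> r A \<le> r B"
  and matroid_rank_submodular: "matroid_rank r \<Longrightarrow> r (A \<union> B) + r (A \<inter> B) \<le> r A + r B"
  by (simp_all add: matroid_rank_def)

lemma matroid_rank_singleton:
  assumes "matroid_rank r" "r A < r (insert e A)"
  shows "r {e} = 1"
proof -
  have "r ({e} \<union> A) \<le> r {e} + r A"
    using matroid_rank_submodular[OF assms(1), of "{e}" A] by simp
  moreover have "r {e} \<le> 1"
    using matroid_rank_insert_le[OF assms(1), of e "{}"] matroid_rank_empty[OF assms(1)] by simp
  ultimately show ?thesis using assms(2) by simp
qed

text \<open>This is the rank function after contracting the non-loop \<open>e\<close>; the truncated
  subtraction is exact because \<open>r (insert e A) \<ge> 1\<close>.\<close>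

lemma matroid_rank_contract:
  assumes "matroid_rank r" "r {e} = 1"
  shows "matroid_rank (\<lambda>A. r (insert e A) - 1)"
proof -
  have ge: "r (insert e A) \<ge> 1" for A
    using matroid_rank_mono[OF assms(1), of "{e}" "insert e A"] assms(2) by simp
  show ?thesis
    unfolding matroid_rank_def
  proof (intro conjI allI impI)
    show "r (insert e {}) - 1 = 0" using assms(2) by simp
    show "r (insert e (insert x A)) - 1 \<le> Suc (r (insert e A) - 1)" for x A
      using matroid_rank_insert_le[OF assms(1), of x "insert e A"] by (simp add: insert_commute)
    show "r (insert e A) - 1 \<le> r (insert e B) - 1" if "A \<subseteq> B" for A B
      using that by (intro diff_le_mono matroid_rank_mono[OF assms(1)] insert_mono)
    show "r (insert e (A \<union> B)) - 1 + (r (insert e (A \<inter> B)) - 1)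
        \<le> r (insert e A) - 1 + (r (insert e B) - 1)" for A B
      using ge[of A] ge[of B] ge[of "A \<union> B"] ge[of "A \<inter> B"]
        matroid_rank_submodular[OF assms(1), of "insert e A" "insert e B"] by simp
  qed
qed

text \<open>Hard direction of Edmonds' min-max theorem: \<open>e\<close> is deleted if the rank
  condition survives on \<open>S\<close>, and contracted otherwise.\<close>

theorem matroid_intersection:
  assumes "finite S" "matroid_rank r1" "matroid_rank r2"
    and "\<And>A. A \<subseteq> S \<Longrightarrow> k \<le> r1 A + r2 (S - A)"
  shows "\<exists>I\<subseteq>S. card I = k \<and> r1 I = k \<and> r2 I = k"
  using assms
proof (induction S arbitrary: r1 r2 k rule: finite_induct)
  case empty
  have "k = 0" using empty(3)[of "{}"] by (simp add: matroid_rank_empty[OF empty(1)] matroid_rank_empty[OF empty(2)])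
  then show ?case by (simp add: matroid_rank_empty[OF empty(1)] matroid_rank_empty[OF empty(2)])
next
  case (insert e S)
  show ?case
  proof (cases "\<forall>A\<subseteq>S. k \<le> r1 A + r2 (S - A)")
    case True
    then show ?thesis using insert.IH[OF insert.prems(1,2), of k] by blast
  next
    case False
    then obtain A where A: "A \<subseteq> S" "r1 A + r2 (S - A) < k" by (meson not_le)
    \<comment> \<open>The condition fails at \<open>A\<close> in \<open>S\<close> but holds in
      \<open>insert e S\<close>, so adding \<open>e\<close> to either side raises its rank; hence
      \<open>e\<close> is a loop of neither matroid.\<close>
    have "k \<le> r1 (insert e A) + r2 (S - A)"
    proof -
      have "insert e S - insert e A = S - A" using insert.hyps by auto
      then show ?thesis using insert.prems(3)[of "insert e A"] A(1) by auto
    qed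
    then have e1: "r1 {e} = 1" using A(2) by (intro matroid_rank_singleton[OF insert.prems(1), of A]) simp
    have "k \<le> r1 A + r2 (insert e (S - A))"
    proof -
      have "insert e S - A = insert e (S - A)" using insert.hyps A(1) by auto
      then show ?thesis using insert.prems(3)[of A] A(1) by auto
    qed
    then have e2: "r2 {e} = 1" using A(2) by (intro matroid_rank_singleton[OF insert.prems(2), of "S - A"]) simp
    have ge1: "r1 (insert e B) \<ge> 1" for B
      using matroid_rank_mono[OF insert.prems(1), of "{e}" "insert e B"] e1 by simp
    have ge2: "r2 (insert e B) \<ge> 1" for B
      using matroid_rank_mono[OF insert.prems(2), of "{e}" "insert e B"] e2 by simp
    \<comment> \<open>Uncrossing: the hypotheses at \<open>insert e (A \<union> B)\<close> and
      \<open>A \<inter> B\<close> total \<open>2 * k\<close>, submodularity moves this to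
      \<open>A\<close> and \<open>B\<close>, and \<open>A\<close> accounts for at most
      \<open>k - 1\<close>. The remainder, at least \<open>k + 1\<close>, loses one in each
      contracted rank.\<close>
    have "k - 1 \<le> r1 (insert e B) - 1 + (r2 (insert e (S - B)) - 1)" if B: "B \<subseteq> S" for B
    proof -
      have "k \<le> r1 (insert e (A \<union> B)) + r2 ((S - A) \<inter> (S - B))"
      proof -
        have "insert e S - insert e (A \<union> B) = (S - A) \<inter> (S - B)" using insert.hyps by auto
        then show ?thesis using insert.prems(3)[of "insert e (A \<union> B)"] A(1) B by auto
      qed
      moreover have "k \<le> r1 (A \<inter> B) + r2 (insert e ((S - A) \<union> (S - B)))"
      proof -
        have "insert e S - (A \<inter> B) = insert e ((S - A) \<union> (S - B))" using insert.hyps A(1) B by auto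
        then show ?thesis using insert.prems(3)[of "A \<inter> B"] A(1) B by auto
      qed
      moreover have "r1 (insert e (A \<union> B)) + r1 (A \<inter> B) \<le> r1 A + r1 (insert e B)"
      proof -
        have "A \<inter> insert e B = A \<inter> B" using insert.hyps A(1) by auto
        then show ?thesis using matroid_rank_submodular[OF insert.prems(1), of A "insert e B"] by simp
      qed
      moreover have "r2 (insert e ((S - A) \<union> (S - B))) + r2 ((S - A) \<inter> (S - B))
          \<le> r2 (S - A) + r2 (insert e (S - B))"
      proof -
        have "(S - A) \<inter> insert e (S - B) = (S - A) \<inter> (S - B)" using insert.hyps by auto
        then show ?thesis
          using matroid_rank_submodular[OF insert.prems(2), of "S - A" "insert e (S - B)"] by simp
      qed
      ultimately show ?thesis using A(2) ge1[of B] ge2[of "S - B"] by linarith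
    qed
    then obtain I where I: "I \<subseteq> S" "card I = k - 1" "r1 (insert e I) - 1 = k - 1"
      "r2 (insert e I) - 1 = k - 1"
      using insert.IH[OF matroid_rank_contract[OF insert.prems(1) e1]
          matroid_rank_contract[OF insert.prems(2) e2], of "k - 1"] by blast
    have "card (insert e I) = Suc (card I)"
      using I(1) insert.hyps by (meson card_insert_disjoint finite_subset subsetD)
    moreover have "insert e I \<subseteq> insert e S" using I(1) by auto
    ultimately show ?thesis
      using I A(2) ge1[of I] ge2[of I] by (intro exI[of _ "insert e I"]) auto
  qed
qed

section \<open>Dimension\<close>

lemma dim_Un_Int_span:
  fixes X Y :: "('a::field ^ 'n) set"
  shows "vec.dim (X \<union> Y) + vec.dim (vec.span X \<inter> vec.span Y) = vec.dim X + vec.dim Y"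
  using vec.dim_sums_Int[OF vec.subspace_span[of X] vec.subspace_span[of Y]]
  by (simp only: vec.span_Un[symmetric] vec.dim_span)

lemma dim_Un_add_dim_le:
  fixes X Y Z :: "('a::field ^ 'n) set"
  assumes "Z \<subseteq> vec.span X" "Z \<subseteq> vec.span Y"
  shows "vec.dim (X \<union> Y) + vec.dim Z \<le> vec.dim X + vec.dim Y"
proof -
  have "vec.dim Z \<le> vec.dim (vec.span X \<inter> vec.span Y)"
    using assms by (intro vec.dim_subset) auto
  then show ?thesis using dim_Un_Int_span[of X Y] by linarith
qed

lemma dim_insert_le:
  fixes x :: "'a::field ^ 'n"
  shows "vec.dim (insert x X) \<le> Suc (vec.dim X)"
  by (simp add: vec.dim_insert)

text \<open>The linear matroid represented by \<open>f\<close>. Submodularity holds because the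
  image of \<open>A \<inter> B\<close> lies in both spans.\<close>

lemma matroid_rank_dim_image:
  fixes f :: "'e \<Rightarrow> 'a::field ^ 'n"
  shows "matroid_rank (\<lambda>A. vec.dim (f ` A))"
  unfolding matroid_rank_def
proof (intro conjI allI impI)
  fix A B
  have "f ` (A \<inter> B) \<subseteq> vec.span (f ` A)" "f ` (A \<inter> B) \<subseteq> vec.span (f ` B)"
    by (auto intro: vec.span_base)
  then show "vec.dim (f ` (A \<union> B)) + vec.dim (f ` (A \<inter> B)) \<le> vec.dim (f ` A) + vec.dim (f ` B)"
    unfolding image_Un by (rule dim_Un_add_dim_le)
qed (auto simp: dim_insert_le intro: vec.dim_subset)

text \<open>The dimension is at most the size of the image, which is at most \<open>card I\<close>;
  equality throughout gives both claims.\<close>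

lemma card_eq_dim_imageD:
  fixes f :: "'e \<Rightarrow> 'a::field ^ 'n"
  assumes "finite I" "vec.dim (f ` I) = card I"
  shows "inj_on f I" "vec.independent (f ` I)"
proof -
  have "vec.dim (f ` I) \<le> card (f ` I)" using assms(1) by (intro vec.dim_le_card vec.span_superset) auto
  then show "inj_on f I" using assms card_image_le[OF assms(1), of f] by (intro eq_card_imp_inj_on) auto
  then show "vec.independent (f ` I)"
    using assms by (intro vec.card_le_dim_spanning[of _ "f ` I"]) (auto simp: card_image vec.span_superset)
qed

lemma length_filter_le_dim:
  fixes vs :: "('a::field ^ 'n) list"
  assumes "distinct vs" "vec.independent (set vs)"
  shows "length (filter (\<lambda>v. v \<in> U) vs) \<le> vec.dim U"
proof -
  have "length (filter (\<lambda>v. v \<in> U) vs) = card (set (filter (\<lambda>v. v \<in> U) vs))"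
    by (metis assms(1) distinct_card distinct_filter)
  also have "\<dots> \<le> vec.dim U"
    by (intro vec.independent_card_le_dim vec.independent_mono[OF assms(2)]) auto
  finally show ?thesis .
qed

lemma length_basis_list:
  fixes vs :: "('a::field ^ 'n) list"
  assumes "basis_list vs"
  shows "length vs = CARD('n)"
proof -
  have vs: "distinct vs" "vec.independent (set vs)" "vec.span (set vs) = UNIV"
    using assms by (simp_all add: basis_list_def)
  have "length vs = vec.dim (vec.span (set vs))"
    by (simp only: vec.dim_span_eq_card_independent[OF vs(2)] distinct_card[OF vs(1)])
  then show ?thesis by (simp only: vs(3) vec_dim_card)
qed

lemma extend_to_basis:
  fixes X :: "('a::field ^ 'n) set"
  assumes "vec.independent X"
  obtains B where "X \<subseteq> B" "vec.independent B" "vec.span B = UNIV" "finite B" "card B = CARD('n)"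
proof -
  obtain B where B: "X \<subseteq> B" "vec.independent B" "UNIV \<subseteq> vec.span B"
    by (rule vec.maximal_independent_subset_extend[OF subset_UNIV assms])
  then have "vec.span B = UNIV" by auto
  moreover have "finite B" using B(2) by (rule vec.finiteI_independent)
  moreover have "vec.dim (vec.span B) = card B"
    by (rule vec.dim_span_eq_card_independent[OF B(2)])
  ultimately show thesis
    using that[OF B(1,2)] by (simp add: vec_dim_card del: vec.dim_UNIV vec.dim_span)
qed

text \<open>The ground set \<open>R\<close> may be infinite. A cover of total dimension \<open>m\<close> of a maximum common
  independent set \<open>I\<close> of size \<open>m\<close> is spanned by a partition of \<open>I\<close>; so if none of the finitely
  many partitions covered \<open>R\<close>, finitely many elements of \<open>R\<close> would witness this.\<close>

lemma linear_matroid_intersection: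
  fixes R :: "(('a::field ^ 'n) \<times> ('a ^ 'n)) set"
  obtains I U W where "I \<subseteq> R" "finite I" "inj_on fst I" "inj_on snd I"
    "vec.independent (fst ` I)" "vec.independent (snd ` I)"
    "\<And>v w. (v, w) \<in> R \<Longrightarrow> v \<in> U \<or> w \<in> W" "vec.dim U + vec.dim W \<le> card I"
proof -
  define ind where "ind I \<longleftrightarrow> I \<subseteq> R \<and> finite I \<and> vec.dim (fst ` I) = card I \<and> vec.dim (snd ` I) = card I" for I
  have bound: "\<forall>I. ind I \<longrightarrow> card I < Suc CARD('n)"
    unfolding ind_def by (metis dim_subset_UNIV_cart_gen less_Suc_eq_le)
  have "ind {}" by (simp add: ind_def)
  then obtain I where indI: "ind I" and max: "\<And>J. ind J \<Longrightarrow> card J \<le> card I"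
    using ex_has_greatest_nat[OF _ bound] by blast
  have I: "I \<subseteq> R" "finite I" "vec.dim (fst ` I) = card I" "vec.dim (snd ` I) = card I"
    using indI by (simp_all add: ind_def)
  have "\<exists>J\<subseteq>I. \<forall>(v, w)\<in>R. v \<in> vec.span (fst ` J) \<or> w \<in> vec.span (snd ` (I - J))"
  proof (rule ccontr)
    assume "\<not> ?thesis"
    then have "\<forall>J\<in>Pow I. \<exists>e. e \<in> R \<and> fst e \<notin> vec.span (fst ` J) \<and> snd e \<notin> vec.span (snd ` (I - J))"
      by (auto simp: split_beta) (metis prod.collapse)
    then obtain g where g: "\<And>J. J \<subseteq> I \<Longrightarrow> g J \<in> R" "\<And>J. J \<subseteq> I \<Longrightarrow> fst (g J) \<notin> vec.span (fst ` J)"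
      "\<And>J. J \<subseteq> I \<Longrightarrow> snd (g J) \<notin> vec.span (snd ` (I - J))"
      by (metis PowI)
    \<comment> \<open>A finite ground set: \<open>I\<close> together with one uncovered pair
      \<open>g J\<close> for each partition of \<open>I\<close> into \<open>J\<close> and
      \<open>I - J\<close>.\<close>
    define S where "S = I \<union> g ` Pow I"
    have S: "finite S" "S \<subseteq> R" using I g(1) by (auto simp: S_def)
    have "\<not> (\<exists>J\<subseteq>S. card J = Suc (card I) \<and> vec.dim (fst ` J) = Suc (card I)
        \<and> vec.dim (snd ` J) = Suc (card I))"
    proof
      assume "\<exists>J\<subseteq>S. card J = Suc (card I) \<and> vec.dim (fst ` J) = Suc (card I)
        \<and> vec.dim (snd ` J) = Suc (card I)"
      then obtain J where "J \<subseteq> S" "card J = Suc (card I)" "vec.dim (fst ` J) = Suc (card I)"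
        "vec.dim (snd ` J) = Suc (card I)" by blast
      then show False using max[of J] S finite_subset[of J S] by (auto simp: ind_def)
    qed
    then obtain A where A: "A \<subseteq> S" "vec.dim (fst ` A) + vec.dim (snd ` (S - A)) \<le> card I"
      using matroid_intersection[OF S(1) matroid_rank_dim_image[of fst] matroid_rank_dim_image[of snd],
          of "Suc (card I)"] by (metis not_less_eq_eq)
    \<comment> \<open>The total rank of \<open>A\<close> and \<open>S - A\<close> is at most
      \<open>card I\<close>, which is the total rank of \<open>J\<close> and \<open>I - J\<close>.
      Hence these parts span their sides, one of which contains \<open>g J\<close>, contrary to its
      choice.\<close>
    define J where "J = I \<inter> A"
    have J: "J \<subseteq> I" "I - J = I - A" by (auto simp: J_def)
    have "inj_on fst I" "vec.independent (fst ` I)" "inj_on snd I" "vec.independent (snd ` I)"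
      using card_eq_dim_imageD[of I fst] card_eq_dim_imageD[of I snd] I by auto
    then have "vec.dim (fst ` J) = card J" "vec.dim (snd ` (I - J)) = card (I - J)"
      using J(1) vec.dim_eq_card_independent[of "fst ` J"] vec.dim_eq_card_independent[of "snd ` (I - J)"]
      by (metis card_image inj_on_subset image_mono vec.independent_mono Diff_subset)+
    moreover have "card J + card (I - J) = card I"
      using J(1) I(2) by (metis card_Diff_subset card_mono finite_subset le_add_diff_inverse)
    moreover have sub: "fst ` J \<subseteq> fst ` A" "snd ` (I - J) \<subseteq> snd ` (S - A)"
      by (auto simp: J_def S_def)
    moreover from sub have "vec.dim (fst ` J) \<le> vec.dim (fst ` A)"
      "vec.dim (snd ` (I - J)) \<le> vec.dim (snd ` (S - A))" by (auto intro: vec.dim_subset)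
    ultimately have "vec.dim (fst ` A) \<le> vec.dim (fst ` J)"
      "vec.dim (snd ` (S - A)) \<le> vec.dim (snd ` (I - J))" using A(2) by linarith+
    then have "vec.span (fst ` A) = vec.span (fst ` J)"
      "vec.span (snd ` (S - A)) = vec.span (snd ` (I - J))"
      using sub vec.dim_eq_span by metis+
    moreover have "g J \<in> A \<or> g J \<in> S - A" using J(1) by (auto simp: S_def)
    ultimately show False using g(2,3)[OF J(1)] by (metis imageI vec.span_base)
  qed
  then obtain J where J: "J \<subseteq> I"
    and "\<forall>(v, w)\<in>R. v \<in> vec.span (fst ` J) \<or> w \<in> vec.span (snd ` (I - J))" by blast
  then have cov: "v \<in> vec.span (fst ` J) \<or> w \<in> vec.span (snd ` (I - J))" if "(v, w) \<in> R" for v w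
    using that by auto
  have finJ: "finite J" using J I(2) by (rule finite_subset)
  have "vec.dim (vec.span (fst ` J)) \<le> card J" "vec.dim (vec.span (snd ` (I - J))) \<le> card (I - J)"
    using I(2) finJ vec.dim_le_card'[of "fst ` J"] vec.dim_le_card'[of "snd ` (I - J)"]
      card_image_le[of J fst] card_image_le[of "I - J" snd] by auto
  moreover have "card J + card (I - J) = card I"
    using J I(2) by (metis card_Diff_subset card_mono finite_subset le_add_diff_inverse)
  ultimately have "vec.dim (vec.span (fst ` J)) + vec.dim (vec.span (snd ` (I - J))) \<le> card I" by simp
  then show thesis
    using that[OF I(1,2) _ _ _ _ cov] I card_eq_dim_imageD[of I fst] card_eq_dim_imageD[of I snd] by auto
qed

section \<open>Path partitions\<close>

text \<open>Induction removing a source \<open>x\<close>: it is prepended to the path headed by its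
  successor, or forms a path of its own. Only the latter adds a path, so each edge saves
  one.\<close>

lemma path_partition:
  assumes "finite X" "E \<subseteq> X \<times> X" "acyclic E" "single_valued E" "single_valued (E\<inverse>)"
  shows "\<exists>D. (\<forall>c\<in>set D. c \<noteq> [] \<and> successively (\<lambda>x y. (x, y) \<in> E) c) \<and> distinct (concat D) \<and>
    set (concat D) = X \<and> length D + card E = card X"
  using assms
proof (induction X arbitrary: E rule: finite_psubset_induct)
  case (psubset X)
  show ?case
  proof (cases "X = {}")
    case True
    then show ?thesis using psubset.prems by (intro exI[of _ "[]"]) auto
  next
    case False
    have finE: "finite E"
      using psubset.prems(1) psubset.hyps by (meson finite_SigmaI finite_subset)
    then have "wf E" using psubset.prems(2) by (rule finite_acyclic_wf)
    then obtain x where "x \<in> X" "\<forall>y. (y, x) \<in> E \<longrightarrow> y \<notin> X"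
      using False unfolding wf_eq_minimal by blast
    then have x: "x \<in> X" "\<And>y. (y, x) \<notin> E" using psubset.prems(1) by auto
    define E' where "E' = E \<inter> (X - {x}) \<times> (X - {x})"
    have sub: "E' \<subseteq> E" by (auto simp: E'_def)
    have E'X: "E' \<subseteq> (X - {x}) \<times> (X - {x})" by (auto simp: E'_def)
    have less: "X - {x} \<subset> X" using x(1) by auto
    have acyclic: "acyclic E'" using psubset.prems(2) sub by (rule acyclic_subset)
    have "single_valued E'" "single_valued (E'\<inverse>)"
      using single_valued_subset[OF sub psubset.prems(3)]
        single_valued_subset[OF _ psubset.prems(4), of "E'\<inverse>"] sub by simp_all
    from psubset.IH[OF less E'X acyclic this] obtain D where
      "\<forall>c\<in>set D. c \<noteq> [] \<and> successively (\<lambda>x y. (x, y) \<in> E') c"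
      and D: "distinct (concat D)" "set (concat D) = X - {x}" "length D + card E' = card (X - {x})"
      by (elim exE conjE)
    then have D': "c \<noteq> []" "successively (\<lambda>x y. (x, y) \<in> E') c" if "c \<in> set D" for c
      using that by auto
    have D_E: "successively (\<lambda>x y. (x, y) \<in> E) c" if "c \<in> set D" for c
      using D'(2)[OF that] sub by (auto elim: successively_mono)
    have cX: "card X = Suc (card (X - {x}))" using psubset.hyps x(1) by (metis card_Suc_Diff1)
    show ?thesis
    proof (cases "\<exists>y. (x, y) \<in> E")
      case False
      then have "E' = E" using x(2) psubset.prems(1) by (auto simp: E'_def)
      have "set (concat ([x] # D)) = X" using x(1) D(2) by auto
      moreover have "distinct (concat ([x] # D))" using D(1,2) by auto
      moreover have "length ([x] # D) + card E = card X" using D(3) cX \<open>E' = E\<close> by simp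
      moreover have "\<forall>c\<in>set ([x] # D). c \<noteq> [] \<and> successively (\<lambda>x y. (x, y) \<in> E) c"
        using D'(1) D_E by auto
      ultimately show ?thesis by (intro exI[of _ "[x] # D"] conjI)
    next
      case True
      then obtain y where y: "(x, y) \<in> E" by blast
      have yx: "y \<in> X - {x}" using y x(2) psubset.prems(1) by auto
      have "E = insert (x, y) E'"
        using y x(2) psubset.prems(1,3) by (auto simp: E'_def single_valued_def)
      moreover have "(x, y) \<notin> E'" by (auto simp: E'_def)
      moreover have "finite E'" using finE sub finite_subset by blast
      ultimately have cE: "card E = Suc (card E')" by simp
      obtain c where c: "c \<in> set D" "y \<in> set c" using yx D(2) by auto
      obtain as bs where asbs: "c = as @ y # bs" using c(2) by (meson split_list)
      \<comment> \<open>A predecessor of \<open>y\<close> on its path would be \<open>x\<close>, as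
        \<open>E\<close> is single-valued backwards, but \<open>x\<close> has been removed.\<close>
      have "as = []"
      proof (rule ccontr)
        assume "as \<noteq> []"
        then have "(last as, y) \<in> E'" using D'(2)[OF c(1)] by (simp add: asbs successively_append_iff)
        moreover from this have "last as = x"
          using y sub single_valuedD[OF psubset.prems(4), of y "last as" x] by auto
        ultimately show False using E'X by auto
      qed
      obtain D1 D2 where D12: "D = D1 @ c # D2" using c(1) by (meson split_list)
      let ?D = "D1 @ (x # c) # D2"
      have "set (concat ?D) = X" using x(1) D(2) by (auto simp: D12)
      moreover have "distinct (concat ?D)" using D(1,2) by (auto simp: D12)
      moreover have "length ?D + card E = card X" using D(3) cX cE by (simp add: D12)
      moreover have "\<forall>c\<in>set ?D. c \<noteq> [] \<and> successively (\<lambda>x y. (x, y) \<in> E) c"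
        using D'(1) D_E y c(1) by (auto simp: D12 asbs \<open>as = []\<close>)
      ultimately show ?thesis by (intro exI[of _ ?D] conjI)
    qed
  qed
qed

section \<open>Antichains and bi-chains\<close>

text \<open>Each consecutive pair is charged to its first entry by \<open>P\<close> or to its second
  by \<open>Q\<close>, and no entry is charged twice for the same predicate.\<close>

lemma length_le_successively_cover:
  assumes "successively (\<lambda>x y. P x \<or> Q y) c"
  shows "length c \<le> Suc (length (filter P c) + length (filter Q c))"
proof (cases c)
  case (Cons x ys)
  have "length ys \<le> length (filter P (x # ys)) + length (filter Q ys)"
    using assms unfolding Cons
  proof (induction ys arbitrary: x)
    case (Cons y ys)
    then have "length ys \<le> length (filter P (y # ys)) + length (filter Q ys)" by simp
    then show ?case using Cons.prems by (auto split: if_splits)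
  qed simp
  then show ?thesis using Cons by auto
qed simp

section \<open>Orthogonality with respect to a definite form\<close>

text \<open>These axioms are common to the real inner product and the Hermitian product, whereas
  bilinearity holds only for the former.\<close>

locale definite_form =
  fixes form :: "'a::field ^ 'n \<Rightarrow> 'a ^ 'n \<Rightarrow> 'a"
  assumes form_add: "form (u + v) w = form u w + form v w"
    and form_scale: "form (c *s v) w = c * form v w"
    and form_sym: "form v w = 0 \<Longrightarrow> form w v = 0"
    and form_definite: "form v v = 0 \<Longrightarrow> v = 0"
begin

abbreviation perp :: "'a ^ 'n \<Rightarrow> 'a ^ 'n \<Rightarrow> bool" where
  "perp v w \<equiv> form v w = 0"

definition complement :: "('a ^ 'n) set \<Rightarrow> ('a ^ 'n) set" where
  "complement X = {v. \<forall>x\<in>X. perp v x}"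

lemma subspace_complement: "vec.subspace (complement X)"
proof -
  have "perp 0 w" for w using form_scale[of 0 0 w] by simp
  then show ?thesis by (simp add: vec.subspace_def complement_def form_add form_scale)
qed

lemma complement_swap: "X \<subseteq> complement Y \<longleftrightarrow> Y \<subseteq> complement X"
  by (auto simp: complement_def dest: form_sym)

lemma span_subset_complement: "X \<subseteq> complement Y \<Longrightarrow> vec.span X \<subseteq> complement Y"
  by (simp add: vec.span_minimal subspace_complement)

text \<open>By definiteness orthogonal spans meet only in zero.\<close>

lemma dim_Un_perp:
  assumes "X \<subseteq> complement Y"
  shows "vec.dim X + vec.dim Y \<le> vec.dim (X \<union> Y)"
proof -
  have "vec.span X \<subseteq> complement (vec.span Y)"
    using assms by (metis complement_swap span_subset_complement)
  then have "vec.span X \<inter> vec.span Y \<subseteq> {0}"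
    by (auto simp: complement_def intro: form_definite)
  then have "vec.dim (vec.span X \<inter> vec.span Y) = 0"
    by (simp only: vec.dim_eq_0)
  then show ?thesis using dim_Un_Int_span[of X Y] by linarith
qed

text \<open>\<open>complement {x}\<close> is the kernel of a linear functional, so one vector of
  \<open>S\<close> outside it suffices to span \<open>S\<close> again.\<close>

lemma dim_inter_complement_singleton:
  assumes "vec.subspace S"
  shows "vec.dim S \<le> Suc (vec.dim (S \<inter> complement {x}))"
proof (cases "S \<subseteq> complement {x}")
  case True
  then show ?thesis by (simp add: Int_absorb2)
next
  case False
  then obtain s where s: "s \<in> S" "form s x \<noteq> 0" by (auto simp: complement_def)
  have "y \<in> vec.span (insert s (S \<inter> complement {x}))" if "y \<in> S" for y
  proof -
    define k where "k = form y x / form s x"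
    have "y + (- k) *s s \<in> S \<inter> complement {x}"
      using that s assms unfolding complement_def
      by (auto simp del: vec.scale_minus_left simp: form_add form_scale k_def intro!: vec.subspace_add vec.subspace_scale)
    then have "y + (- k) *s s \<in> vec.span (insert s (S \<inter> complement {x}))"
      by (intro vec.span_base) auto
    moreover have "k *s s \<in> vec.span (insert s (S \<inter> complement {x}))"
      by (intro vec.span_scale vec.span_base) auto
    ultimately have "(y + (- k) *s s) + k *s s \<in> vec.span (insert s (S \<inter> complement {x}))"
      by (rule vec.span_add)
    then show ?thesis by (simp add: vec.scale_minus_left)
  qed
  then have "vec.dim S \<le> vec.dim (insert s (S \<inter> complement {x}))"
    by (metis subsetI vec.dim_span vec.dim_subset)
  then show ?thesis using dim_insert_le order_trans by blast
qed

text \<open>Each vector of a basis of \<open>X\<close> costs at most one dimension, and whatever is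
  orthogonal to the basis is orthogonal to \<open>X\<close>.\<close>

lemma dim_complement_ge: "CARD('n) \<le> vec.dim (complement X) + vec.dim X"
proof -
  have fin: "CARD('n) \<le> vec.dim (complement B) + card B" if "finite B" for B
    using that
  proof (induction B)
    case empty
    then show ?case by (simp add: complement_def vec_dim_card del: vec.dim_UNIV)
  next
    case (insert x B)
    have "complement (insert x B) = complement B \<inter> complement {x}" by (auto simp: complement_def)
    then show ?case
      using insert dim_inter_complement_singleton[OF subspace_complement, of B x] by simp
  qed
  obtain B where B: "B \<subseteq> X" "vec.independent B" "X \<subseteq> vec.span B" "card B = vec.dim X"
    using vec.basis_exists by blast
  have "complement B \<subseteq> complement X"
    using B(3) span_subset_complement complement_swap by (metis order_refl order_trans)
  then have "vec.dim (complement B) \<le> vec.dim (complement X)" by (rule vec.dim_subset)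
  then show ?thesis using fin[OF vec.finiteI_independent[OF B(2)]] B(4) by simp
qed

section \<open>Antichains as lower bounds for decompositions\<close>

lemma antichain_subspace_iff:
  "antichain_subspace perp R C \<longleftrightarrow>
     vec.subspace C \<and> (\<forall>(v, w)\<in>R. v \<in> complement C \<or> w \<in> complement C)"
  by (auto simp: antichain_subspace_def complement_def)

text \<open>For the dimensions, \<open>U\<close> is orthogonal to \<open>C\<close> because
  \<open>C\<close> is an antichain, and \<open>W\<close> is orthogonal to
  \<open>U \<union> C\<close> by definition.\<close>

lemma antichain_cover:
  assumes R: "linorder_rel perp R" and C: "antichain_subspace perp R C"
  obtains U W where "\<And>v w. (v, w) \<in> R \<Longrightarrow> v \<in> U \<or> w \<in> W"
    "vec.dim U + vec.dim W + vec.dim C \<le> CARD('n)"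
proof -
  have trans: "(v, w') \<in> R" if "(v, w) \<in> R" "(v', w') \<in> R" "\<not> perp w v'" for v w v' w'
    using R that unfolding linorder_rel_def by blast
  have anti: "v \<in> complement C \<or> w \<in> complement C" if "(v, w) \<in> R" for v w
    using C that unfolding antichain_subspace_iff by blast
  define U where "U = {v. \<exists>w. (v, w) \<in> R \<and> w \<notin> complement C}"
  define W where "W = complement (U \<union> C)"
  have "v \<in> U \<or> w \<in> W" if vw: "(v, w) \<in> R" for v w
  proof (rule disjCI)
    assume "w \<notin> W"
    show "v \<in> U"
    proof (cases "w \<in> complement C")
      case False
      then show ?thesis using vw by (auto simp: U_def)
    next
      case True
      \<comment> \<open>Transitivity through the nonorthogonal \<open>w\<close> and \<open>u\<close>
        carries a witness for \<open>u \<in> U\<close> over to \<open>v\<close>.\<close>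
      then obtain u where u: "u \<in> U" "\<not> perp w u" using \<open>w \<notin> W\<close> by (auto simp: W_def complement_def)
      then obtain x where "(u, x) \<in> R" "x \<notin> complement C" by (auto simp: U_def)
      then show ?thesis using trans[OF vw _ u(2)] by (auto simp: U_def)
    qed
  qed
  moreover have "U \<subseteq> complement C" using anti by (auto simp: U_def)
  then have "vec.dim U + vec.dim C \<le> vec.dim (U \<union> C)" by (rule dim_Un_perp)
  moreover have "vec.dim W + vec.dim (U \<union> C) \<le> vec.dim (W \<union> (U \<union> C))"
    by (rule dim_Un_perp) (simp add: W_def)
  moreover have "vec.dim (W \<union> (U \<union> C)) \<le> CARD('n)" by (rule dim_subset_UNIV_cart_gen)
  ultimately show thesis by (intro that[of U W]) auto
qed

text \<open>Summing the link counts over all bi-chains gives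
  \<open>CARD('n) \<le> length D + vec.dim U + vec.dim W\<close>.\<close>

lemma dim_antichain_le_length_decomposition:
  assumes R: "linorder_rel perp R" and C: "antichain_subspace perp R C"
    and D: "bichain_decomposition perp R D"
  shows "vec.dim C \<le> length D"
proof -
  obtain U W where cov: "\<And>v w. (v, w) \<in> R \<Longrightarrow> v \<in> U \<or> w \<in> W"
    and dims: "vec.dim U + vec.dim W + vec.dim C \<le> CARD('n)"
    using antichain_cover[OF R C] by blast
  let ?P = "\<lambda>x. snd x \<in> U" and ?Q = "\<lambda>x. fst x \<in> W"
  have "length c \<le> Suc (length (filter ?P c) + length (filter ?Q c))" if "c \<in> set D" for c
    using D that cov
    by (intro length_le_successively_cover)
      (auto simp: bichain_decomposition_def bichain_def successively_conv_nth)
  then have "length (concat D) \<le> length D + length (filter ?P (concat D)) + length (filter ?Q (concat D))"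
    by (induction D) (auto simp: fun_eq_iff, fastforce)
  moreover have "length (filter ?P (concat D)) \<le> vec.dim U"
    using D length_filter_le_dim[of "map snd (concat D)" U]
    by (simp add: bichain_decomposition_def basis_list_def filter_map o_def)
  moreover have "length (filter ?Q (concat D)) \<le> vec.dim W"
    using D length_filter_le_dim[of "map fst (concat D)" W]
    by (simp add: bichain_decomposition_def basis_list_def filter_map o_def)
  moreover have "length (concat D) = CARD('n)"
    using D length_basis_list[of "map fst (concat D)"]
    by (simp add: bichain_decomposition_def del: length_concat)
  ultimately show ?thesis using dims by linarith
qed

section \<open>Decompositions from independent links\<close>

text \<open>A perfect matching in the bipartite graph of nonorthogonal pairs, found by matroid
  intersection on its edges.\<close>

lemma basis_pairing:
  assumes V: "vec.independent V" "card V = CARD('n)" and W: "vec.independent W" "card W = CARD('n)"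
  obtains P where "\<And>w v. (w, v) \<in> P \<Longrightarrow> \<not> perp w v"
    "inj_on fst P" "inj_on snd P" "fst ` P = W" "snd ` P = V"
proof -
  define S where "S = {(w, v) \<in> W \<times> V. \<not> perp w v}"
  have finV: "finite V" and finW: "finite W" using V W vec.finiteI_independent by auto
  then have finS: "finite S" by (auto simp: S_def intro: finite_subset[of _ "W \<times> V"])
  have "CARD('n) \<le> vec.dim (fst ` A) + vec.dim (snd ` (S - A))" if A: "A \<subseteq> S" for A
  proof -
    have sub: "fst ` A \<subseteq> W" "snd ` (S - A) \<subseteq> V" using A by (auto simp: S_def)
    \<comment> \<open>A nonorthogonal pair between these two sets would be an edge in neither
      \<open>A\<close> nor \<open>S - A\<close>. Being orthogonal and independent, they have at most
      \<open>CARD('n)\<close> elements together.\<close>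
    have "W - fst ` A \<subseteq> complement (V - snd ` (S - A))"
      by (force simp: complement_def S_def image_iff)
    then have "vec.dim (W - fst ` A) + vec.dim (V - snd ` (S - A)) \<le> CARD('n)"
      using dim_Un_perp dim_subset_UNIV_cart_gen order_trans by blast
    moreover have "vec.dim (W - fst ` A) = CARD('n) - card (fst ` A)"
      using W sub finW
      by (simp add: vec.dim_eq_card_independent vec.independent_mono[of W] card_Diff_subset finite_subset)
    moreover have "vec.dim (V - snd ` (S - A)) = CARD('n) - card (snd ` (S - A))"
      using V sub finV
      by (simp add: vec.dim_eq_card_independent vec.independent_mono[of V] card_Diff_subset finite_subset)
    moreover have "vec.dim (fst ` A) = card (fst ` A)" "vec.dim (snd ` (S - A)) = card (snd ` (S - A))"
      using V W sub vec.independent_mono vec.dim_eq_card_independent by metis+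
    ultimately show ?thesis by linarith
  qed
  then obtain P where P: "P \<subseteq> S" "card P = CARD('n)" "vec.dim (fst ` P) = card P" "vec.dim (snd ` P) = card P"
    using matroid_intersection[OF finS matroid_rank_dim_image[of fst] matroid_rank_dim_image[of snd]] by metis
  have finP: "finite P" using P(1) finS finite_subset by blast
  have inj: "inj_on fst P" "inj_on snd P" using card_eq_dim_imageD[OF finP] P(3,4) by auto
  have "fst ` P = W"
    using P(1,2) W(2) inj(1) by (intro card_subset_eq[OF finW]) (auto simp: card_image S_def)
  moreover have "snd ` P = V"
    using P(1,2) V(2) inj(2) by (intro card_subset_eq[OF finV]) (auto simp: card_image S_def)
  ultimately show thesis using that[OF _ inj] P(1) by (auto simp: S_def)
qed

lemma decomposition_of_independent_links:
  assumes R: "linorder_rel perp R" and I: "I \<subseteq> R" "inj_on fst I" "inj_on snd I"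
    "vec.independent (fst ` I)" "vec.independent (snd ` I)"
  obtains D where "bichain_decomposition perp R D" "length D + card I = CARD('n)"
proof -
  have trans: "(v, w') \<in> R" if "(v, w) \<in> R" "(v', w') \<in> R" "\<not> perp w v'" for v w v' w'
    using R that unfolding linorder_rel_def by blast
  have irr: "perp v w" if "(v, w) \<in> R" for v w
    using R that unfolding linorder_rel_def by blast
  obtain V where V: "fst ` I \<subseteq> V" "vec.independent V" "vec.span V = UNIV" "finite V" "card V = CARD('n)"
    using extend_to_basis[OF I(4)] by blast
  obtain W where W: "snd ` I \<subseteq> W" "vec.independent W" "vec.span W = UNIV" "finite W" "card W = CARD('n)"
    using extend_to_basis[OF I(5)] by blast
  obtain P where P: "\<And>w v. (w, v) \<in> P \<Longrightarrow> \<not> perp w v"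
    "inj_on fst P" "inj_on snd P" "fst ` P = W" "snd ` P = V"
    using basis_pairing[OF V(2,5) W(2,5)] by blast
  have finP: "finite P" and cardP: "card P = CARD('n)"
    using P(2,4) W(4,5) by (auto simp: card_image dest: finite_imageD)
  define E where "E = {(x, y) \<in> P \<times> P. (snd x, fst y) \<in> I}"
  \<comment> \<open>Transitivity applies through every inner pair of a path, such pairs being
    nonorthogonal. A cycle would put \<open>(snd x, fst x)\<close> in \<open>R\<close> and so make
    the pair \<open>x\<close> orthogonal.\<close>
  have "acyclic E"
  proof (rule acyclicI, rule allI, rule notI)
    fix x assume "(x, x) \<in> E\<^sup>+"
    moreover have "x \<in> P \<and> y \<in> P \<and> (snd x, fst y) \<in> R" if "(x, y) \<in> E\<^sup>+" for x y
      using that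
    proof (induction rule: trancl_induct)
      case (base y)
      then show ?case using I(1) by (auto simp: E_def)
    next
      case (step y z)
      then have "(snd y, fst z) \<in> R" "z \<in> P" using I(1) by (auto simp: E_def)
      moreover have "\<not> perp (fst y) (snd y)" using step P(1)[of "fst y" "snd y"] by simp
      ultimately show ?case using step trans by blast
    qed
    ultimately have "x \<in> P" "(snd x, fst x) \<in> R" by auto
    then show False using irr form_sym P(1)[of "fst x" "snd x"] by auto
  qed
  moreover have "single_valued E"
  proof (rule single_valuedI)
    fix x y z assume "(x, y) \<in> E" "(x, z) \<in> E"
    then have "y \<in> P" "z \<in> P" "fst y = fst z"
      using inj_onD[OF I(2), of "(snd x, fst y)" "(snd x, fst z)"] by (auto simp: E_def)
    then show "y = z" using inj_onD[OF P(2)] by blast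
  qed
  moreover have "single_valued (E\<inverse>)"
  proof (rule single_valuedI)
    fix x y z assume "(x, y) \<in> E\<inverse>" "(x, z) \<in> E\<inverse>"
    then have "y \<in> P" "z \<in> P" "snd y = snd z"
      using inj_onD[OF I(3), of "(snd y, fst x)" "(snd z, fst x)"] by (auto simp: E_def)
    then show "y = z" using inj_onD[OF P(3)] by blast
  qed
  moreover have "E \<subseteq> P \<times> P" by (auto simp: E_def)
  ultimately obtain D where D: "\<And>c. c \<in> set D \<Longrightarrow> c \<noteq> [] \<and> successively (\<lambda>x y. (x, y) \<in> E) c"
    "distinct (concat D)" "set (concat D) = P" "length D + card E = card P"
    using path_partition[OF finP, of E] by metis
  \<comment> \<open>The bases contain the components of \<open>I\<close>, so each element of
    \<open>I\<close> comes from exactly one edge; hence there are \<open>CARD('n) - card I\<close>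
    paths.\<close>
  have "bij_betw (\<lambda>(x, y). (snd x, fst y)) E I"
  proof (rule bij_betw_imageI)
    show "inj_on (\<lambda>(x, y). (snd x, fst y)) E"
    proof (rule inj_onI)
      fix p q assume E: "p \<in> E" "q \<in> E"
        and eq: "(case p of (x, y) \<Rightarrow> (snd x, fst y)) = (case q of (x, y) \<Rightarrow> (snd x, fst y))"
      obtain x y x' y' where pq: "p = (x, y)" "q = (x', y')" by (meson surj_pair)
      have "snd x = snd x'" "fst y = fst y'" "x \<in> P" "x' \<in> P" "y \<in> P" "y' \<in> P"
        using E eq by (auto simp: pq E_def)
      then have "x = x'" "y = y'" using inj_onD[OF P(3)] inj_onD[OF P(2)] by blast+
      then show "p = q" by (simp add: pq)
    qed
    have "(v, w) \<in> (\<lambda>(x, y). (snd x, fst y)) ` E" if vw: "(v, w) \<in> I" for v w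
    proof -
      have "fst (v, w) \<in> fst ` I" "snd (v, w) \<in> snd ` I" using vw by (rule imageI)+
      then have "v \<in> snd ` P" "w \<in> fst ` P" using subsetD[OF V(1)] subsetD[OF W(1)] P(4,5) by simp_all
      then obtain x y where "x \<in> P" "y \<in> P" "v = snd x" "w = fst y" by auto
      then show ?thesis using vw by (intro image_eqI[of _ _ "(x, y)"]) (auto simp: E_def)
    qed
    then show "(\<lambda>(x, y). (snd x, fst y)) ` E = I" by (auto simp: E_def)
  qed
  then have "card E = card I" by (rule bij_betw_same_card)
  moreover have "bichain perp R c" if "c \<in> set D" for c
  proof -
    have "set c \<subseteq> P" using that D(3) by auto
    then have "\<forall>(w, v)\<in>set c. \<not> perp w v" using P(1) by auto
    moreover have "(snd (c ! i), fst (c ! Suc i)) \<in> R" if "Suc i < length c" for i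
    proof -
      have "(c ! i, c ! Suc i) \<in> E"
        using successively_nth[OF conjunct2[OF D(1)[OF \<open>c \<in> set D\<close>]] that] .
      then show ?thesis using I(1) by (auto simp: E_def)
    qed
    ultimately show ?thesis using D(1)[OF that] by (auto simp: bichain_def)
  qed
  moreover have "basis_list (map snd (concat D))" "basis_list (map fst (concat D))"
    unfolding basis_list_def set_map D(3) distinct_map using D(2) P V W by auto
  ultimately show thesis using D(4) cardP by (intro that[of D]) (auto simp: bichain_decomposition_def)
qed

theorem linear_dilworth:
  assumes R: "linorder_rel perp R"
  shows "\<exists>D C. is_arg_min length (bichain_decomposition perp R) D \<and>
    is_arg_max vec.dim (antichain_subspace perp R) C \<and> length D = vec.dim C"
proof -
  obtain I U W where I: "I \<subseteq> R" "finite I" "inj_on fst I" "inj_on snd I"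
    "vec.independent (fst ` I)" "vec.independent (snd ` I)"
    and cov: "\<And>v w. (v, w) \<in> R \<Longrightarrow> v \<in> U \<or> w \<in> W" and dims: "vec.dim U + vec.dim W \<le> card I"
    using linear_matroid_intersection[of R] by metis
  obtain D where D: "bichain_decomposition perp R D" "length D + card I = CARD('n)"
    using decomposition_of_independent_links[OF R I(1,3-6)] by blast
  define C where "C = complement (U \<union> W)"
  have "U \<union> W \<subseteq> complement C"
    unfolding C_def by (subst complement_swap) (rule order_refl)
  then have "v \<in> complement C \<or> w \<in> complement C" if "(v, w) \<in> R" for v w
    using cov[OF that] by auto
  then have C: "antichain_subspace perp R C"
    using subspace_complement[of "U \<union> W"] by (auto simp: antichain_subspace_iff C_def)
  have "vec.dim (U \<union> W) \<le> vec.dim U + vec.dim W"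
    using dim_Un_add_dim_le[of "{}" U W] by simp
  then have "length D \<le> vec.dim C"
    using dim_complement_ge[of "U \<union> W"] dims D(2) by (simp add: C_def)
  then have eq: "length D = vec.dim C"
    using dim_antichain_le_length_decomposition[OF R C D(1)] by simp
  \<comment> \<open>Every antichain bounds every decomposition from below, so a pair with equality
    is optimal on both sides.\<close>
  have "is_arg_min length (bichain_decomposition perp R) D"
    unfolding is_arg_min_def using D(1) eq dim_antichain_le_length_decomposition[OF R C]
    by (metis not_le)
  moreover have "is_arg_max vec.dim (antichain_subspace perp R) C"
    unfolding is_arg_max_def using C eq dim_antichain_le_length_decomposition[OF R _ D(1)]
    by (metis not_le)
  ultimately show ?thesis using eq by blast
qed

end

section \<open>The real and complex instances\<close>

interpretation real_form: definite_form "inner :: real ^ 'n \<Rightarrow> real ^ 'n \<Rightarrow> real"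
proof
  fix u v w :: "real ^ 'n" and c :: real
  show "inner (u + v) w = inner u w + inner v w" by (rule inner_add_left)
  show "inner (c *s v) w = c * inner v w" by (simp add: scalar_mult_eq_scaleR)
  show "inner w v = 0" if "inner v w = 0" using that by (simp only: inner_commute)
  show "v = 0" if "inner v v = 0" using that by simp
qed

definition hermitian :: "complex ^ 'n \<Rightarrow> complex ^ 'n \<Rightarrow> complex" where
  "hermitian v w = (\<Sum>i\<in>UNIV. v $ i * cnj (w $ i))"

lemma hermitian_cnj: "cnj (hermitian v w) = hermitian w v"
  by (simp add: hermitian_def mult.commute)

interpretation hermitian: definite_form hermitian
proof
  fix u v w :: "complex ^ 'n" and c :: complex
  show "hermitian (u + v) w = hermitian u w + hermitian v w"
    by (simp add: hermitian_def distrib_right sum.distrib)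
  show "hermitian (c *s v) w = c * hermitian v w"
    by (simp add: hermitian_def sum_distrib_left mult.assoc)
  show "hermitian w v = 0" if "hermitian v w = 0"
    using that hermitian_cnj[of v w] by simp
  show "v = 0" if "hermitian v v = 0"
  proof -
    have "hermitian v v = of_real (\<Sum>i\<in>UNIV. (cmod (v $ i))\<^sup>2)"
      by (simp add: hermitian_def complex_norm_square del: of_real_power)
    then have "(\<Sum>i\<in>UNIV. (cmod (v $ i))\<^sup>2) = 0" using that by (metis of_real_eq_0_iff)
    then show ?thesis by (simp add: sum_nonneg_eq_0_iff vec_eq_iff)
  qed
qed

theorem theorem1p13:
  "(\<forall>R :: ((real ^ 'n) \<times> (real ^ 'n)) set. linorder_rel orthogonal R \<longrightarrow>
      (\<exists>D C. is_arg_min length (bichain_decomposition orthogonal R) D \<and>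
             is_arg_max vec.dim (antichain_subspace orthogonal R) C \<and>
             length D = vec.dim C)) \<and>
   (\<forall>R :: ((complex ^ 'n) \<times> (complex ^ 'n)) set. linorder_rel cperp R \<longrightarrow>
      (\<exists>D C. is_arg_min length (bichain_decomposition cperp R) D \<and>
             is_arg_max vec.dim (antichain_subspace cperp R) C \<and>
             length D = vec.dim C))"
proof -
  \<comment> \<open>Both orthogonality relations are brought into the shape
    \<open>form v w = 0\<close> in which the locale states its theorem.\<close>
  have real: "orthogonal = (\<lambda>v w :: real ^ 'n. inner v w = 0)"
    by (simp add: fun_eq_iff orthogonal_def)
  have complex: "cperp = (\<lambda>v w :: complex ^ 'n. hermitian v w = 0)"
    by (simp add: fun_eq_iff cperp_def hermitian_def)
  show ?thesis
    unfolding real complex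
    by (intro conjI allI impI real_form.linear_dilworth hermitian.linear_dilworth)
qed

end
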